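(* Let $\Omega$ be a nonempty compact Hausdorff space, let $k:\Omega\times\Omega\to\mathbb{R}$ be a continuous non-negative function, and let $\mu$ be a positive Radon measure on $\Omega$ such that $\int_\Omega k(x,y)\,d\mu(y)>0$ for all $x\in\Omega$. Put $$\tilde k(x,y)=\frac{k(x,y)}{\int_\Omega k(x,z)\,d\mu(z)},\qquad x,y\in\Omega,$$ and let $T_k$ be the integral operator on $C_{\mathbb{R}}(\Omega)$ given by $T_k(f)(x)=\int_\Omega\tilde k(x,y)f(y)\,d\mu(y)$ for all $x\in\Omega$. If $\|\tilde k\|_\infty<\frac{2}{\mu(\Omega)}$, then there exists a unique invariant probability Radon measure $\tilde v$ on $\Omega$ such that $$|(T_k^* )^n(v)-\tilde v|(\Omega)\to 0\quad\text{as } n\to\infty$$ for all probability Radon measures $v$ on $\Omega$.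
   Context: $C_{\mathbb{R}}(\Omega)$ is the real Banach space of continuous real-valued functions on $\Omega$ with the supremum norm. $M_r(\Omega)$ is the real Banach space of signed Radon measures on $\Omega$ with the total variation norm $\|v\|=|v|(\Omega)$, identified isometrically with the dual of $C_{\mathbb{R}}(\Omega)$ via $v\mapsto(f\mapsto\int_\Omega f\,dv)$. $T_k^*$ is the adjoint of $T_k$, viewed as a bounded linear operator on $M_r(\Omega)$. A measure $\tilde v$ is invariant if $T_k^*(\tilde v)=\tilde v$. $\|\tilde k\|_\infty=\sup_{x,y\in\Omega}|\tilde k(x,y)|$. *)

theory Defs
  imports "HOL-Probability.Probability"
begin

text \<open>
  The space \<open>\<Omega>\<close> is the universe of a type of class \<^class>\<open>t2_space\<close>; compactness is a hypothesis
  of the theorem.  Then every continuous real function is bounded, so the Banach space of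
  continuous real functions on \<open>\<Omega>\<close> with the supremum norm is \<open>'a \<Rightarrow>\<^sub>C real\<close>.
\<close>

definition radon_measure :: "'a::t2_space measure \<Rightarrow> bool" where
  "radon_measure M \<longleftrightarrow>
     sets M = sets borel \<and>
     (\<forall>K. compact K \<longrightarrow> emeasure M K < \<infinity>) \<and>
     (\<forall>A\<in>sets borel. emeasure M A = (SUP K\<in>{K. compact K \<and> K \<subseteq> A}. emeasure M K))"

text \<open>
  A signed measure is a countably additive real set function on the Borel sets.  As for
  \<^const>\<open>measure\<close>, its value on non-Borel sets is fixed to be 0, so that equality of functions is
  equality of signed measures and \<open>measure M\<close> is the signed measure given by a finite Borel
  measure \<open>M\<close>.
\<close>

definition signed_measure :: "('a::topological_space set \<Rightarrow> real) \<Rightarrow> bool" where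
  "signed_measure v \<longleftrightarrow>
     v {} = 0 \<and>
     (\<forall>A. A \<notin> sets borel \<longrightarrow> v A = 0) \<and>
     (\<forall>A :: nat \<Rightarrow> 'a set. range A \<subseteq> sets borel \<longrightarrow> disjoint_family A \<longrightarrow>
        (\<lambda>n. v (A n)) sums v (\<Union>n. A n))"

definition total_variation :: "('a::topological_space set \<Rightarrow> real) \<Rightarrow> 'a set \<Rightarrow> ennreal" where
  "total_variation v A =
     (SUP P\<in>{P. finite P \<and> P \<subseteq> sets borel \<and> disjoint P \<and> \<Union>P = A}. \<Sum>B\<in>P. ennreal \<bar>v B\<bar>)"

definition variation_measure :: "('a::topological_space set \<Rightarrow> real) \<Rightarrow> 'a measure" where
  "variation_measure v = measure_of UNIV (sets borel) (total_variation v)"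

definition signed_radon_measure :: "('a::t2_space set \<Rightarrow> real) \<Rightarrow> bool" where
  "signed_radon_measure v \<longleftrightarrow> signed_measure v \<and> radon_measure (variation_measure v)"

text \<open>
  Integration against a signed measure \<open>v\<close> through its Jordan decomposition, whose parts are
  \<open>(\<bar>v\<bar> + v) / 2\<close> and \<open>(\<bar>v\<bar> - v) / 2\<close>.
\<close>

definition positive_part :: "('a::topological_space set \<Rightarrow> real) \<Rightarrow> 'a measure" where
  "positive_part v =
     measure_of UNIV (sets borel) (\<lambda>A. ennreal ((enn2real (total_variation v A) + v A) / 2))"

definition negative_part :: "('a::topological_space set \<Rightarrow> real) \<Rightarrow> 'a measure" where
  "negative_part v =
     measure_of UNIV (sets borel) (\<lambda>A. ennreal ((enn2real (total_variation v A) - v A) / 2))"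

definition signed_integral :: "('a::topological_space set \<Rightarrow> real) \<Rightarrow> ('a \<Rightarrow> real) \<Rightarrow> real" where
  "signed_integral v f =
     integral\<^sup>L (positive_part v) f - integral\<^sup>L (negative_part v) f"

text \<open>
  The adjoint of an operator \<open>T\<close> on the continuous functions, transported to signed Radon
  measures along the identification of \<open>v\<close> with the functional \<open>f \<mapsto> \<integral>f dv\<close>.  For bounded linear
  \<open>T\<close> and compact \<open>'a\<close>, the measure described exists and is unique by the Riesz representation
  theorem.
\<close>

definition adjoint_on_measures ::
    "(('a::t2_space \<Rightarrow>\<^sub>C real) \<Rightarrow> ('a \<Rightarrow>\<^sub>C real)) \<Rightarrow> ('a set \<Rightarrow> real) \<Rightarrow> ('a set \<Rightarrow> real)" where
  "adjoint_on_measures T v =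
     (THE w. signed_radon_measure w \<and>
        (\<forall>f. signed_integral w (apply_bcontfun f) = signed_integral v (apply_bcontfun (T f))))"

definition normalized_kernel :: "'a measure \<Rightarrow> ('a \<times> 'a \<Rightarrow> real) \<Rightarrow> 'a \<times> 'a \<Rightarrow> real" where
  "normalized_kernel \<mu> k = (\<lambda>(x, y). k (x, y) / (\<integral>z. k (x, z) \<partial>\<mu>))"

text \<open>
  Under the hypotheses of the theorem the integral below is continuous and bounded in \<open>x\<close>, so
  \<^const>\<open>Bcontfun\<close> returns this very function.
\<close>

definition kernel_operator ::
    "'a::t2_space measure \<Rightarrow> ('a \<times> 'a \<Rightarrow> real) \<Rightarrow> ('a \<Rightarrow>\<^sub>C real) \<Rightarrow> ('a \<Rightarrow>\<^sub>C real)" where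
  "kernel_operator \<mu> k f =
     Bcontfun (\<lambda>x. \<integral>y. normalized_kernel \<mu> k (x, y) * apply_bcontfun f y \<partial>\<mu>)"

definition probability_radon_measure :: "'a::t2_space measure \<Rightarrow> bool" where
  "probability_radon_measure M \<longleftrightarrow> prob_space M \<and> radon_measure M"

end

theory Submission
  imports Defs
begin

text \<open>
  The adjoint maps a probability measure \<open>v\<close> to the measure with the continuous density
  \<open>y \<mapsto> \<integral>K(x, y) dv(x)\<close> with respect to \<open>\<mu>\<close>, where \<open>K\<close> is the normalized kernel. After one step
  everything therefore happens on the complete set of continuous probability densities, with the
  sup metric. If \<open>0 \<le> K \<le> C\<close>, the difference \<open>d\<close> of two such densities is mapped to
  \<open>\<integral>d(x) K(x, y) d\<mu>(x) = \<integral>d(x) (K(x, y) - C / 2) d\<mu>(x)\<close>, which is bounded by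
  \<open>C \<mu>(\<Omega>) / 2 \<cdot> \<parallel>d\<parallel>\<close>. The hypothesis makes this factor smaller than 1, and Banach's fixed point
  theorem yields the invariant density together with uniform convergence of the densities, hence
  convergence in total variation.
\<close>

section \<open>Signed measures\<close>

text \<open>The adjoint is a definite description over all signed Radon measures, so computing its
  value requires uniqueness among signed competitors: equal integrals of continuous functions must
  force equal measures. This is why variation measures and Jordan parts are developed, and where
  Urysohn functions and regularity enter. Existence needs no Riesz theorem here: on probability
  measures Fubini exhibits the representing measure explicitly. The constant \<open>C / 2\<close> is
  the midpoint of \<open>[0, C]\<close>. Subtracting it from the kernel is free because the
  difference of two probability densities has integral 0, and it halves the available sup bound;
  this is the origin of the 2 in the hypothesis.\<close>

lemma sum_le_total_variation:
  assumes "finite P" "P \<subseteq> sets borel" "disjoint P" "\<Union>P = A"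
  shows "(\<Sum>B\<in>P. ennreal \<bar>v B\<bar>) \<le> total_variation v A"
  unfolding total_variation_def by (rule SUP_upper) (use assms in auto)

lemma total_variation_least:
  assumes "\<And>P. finite P \<Longrightarrow> P \<subseteq> sets borel \<Longrightarrow> disjoint P \<Longrightarrow> \<Union>P = A \<Longrightarrow>
    (\<Sum>B\<in>P. ennreal \<bar>v B\<bar>) \<le> c"
  shows "total_variation v A \<le> c"
  unfolding total_variation_def by (rule SUP_least) (use assms in auto)

lemma abs_le_total_variation:
  assumes "A \<in> sets borel" "A \<subseteq> C" "C \<in> sets borel"
  shows "ennreal \<bar>v A\<bar> \<le> total_variation v C"
proof -
  have "ennreal \<bar>v A\<bar> = (\<Sum>B\<in>{A}. ennreal \<bar>v B\<bar>)"
    by simp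
  also have "\<dots> \<le> (\<Sum>B\<in>{A, C - A}. ennreal \<bar>v B\<bar>)"
    by (rule sum_mono2) auto
  also have "\<dots> \<le> total_variation v C"
    by (rule sum_le_total_variation) (use assms in \<open>auto simp: disjoint_def\<close>)
  finally show ?thesis .
qed

lemma signed_measure_empty: "signed_measure v \<Longrightarrow> v {} = 0"
  by (simp add: signed_measure_def)

lemma signed_measure_not_borel: "signed_measure v \<Longrightarrow> A \<notin> sets borel \<Longrightarrow> v A = 0"
  by (simp add: signed_measure_def)

lemma signed_measure_sums:
  "signed_measure v \<Longrightarrow> range A \<subseteq> sets borel \<Longrightarrow> disjoint_family A \<Longrightarrow>
    (\<lambda>n::nat. v (A n)) sums v (\<Union>n. A n)"
  by (simp add: signed_measure_def)

lemma signed_measure_add: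
  assumes "signed_measure v" "A \<in> sets borel" "B \<in> sets borel" "A \<inter> B = {}"
  shows "v (A \<union> B) = v A + v B"
proof -
  have "(\<lambda>n. v (binaryset A B n)) sums v (\<Union>n. binaryset A B n)"
    using assms by (intro signed_measure_sums)
      (auto simp: range_binaryset_eq disjoint_family_on_def binaryset_def)
  moreover have "(\<lambda>n. v (binaryset A B n)) sums (v A + v B)"
    by (rule binaryset_sums) (rule signed_measure_empty[OF assms(1)])
  ultimately show ?thesis
    by (metis sums_unique2 UN_binaryset_eq)
qed

lemma signed_measure_diff:
  assumes "signed_measure v" "A \<in> sets borel" "B \<in> sets borel" "B \<subseteq> A"
  shows "v (A - B) = v A - v B"
  using signed_measure_add[of v B "A - B"] assms
  by (simp add: Un_absorb1)

lemma total_variation_empty: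
  assumes "signed_measure v" shows "total_variation v {} = 0"
proof -
  have "total_variation v {} \<le> 0"
    by (rule total_variation_least)
      (auto intro!: sum.neutral simp: signed_measure_empty[OF assms])
  then show ?thesis by simp
qed

text \<open>A partition of \<open>A\<close> and a partition of \<open>B\<close> together form a
  partition of the union.\<close>

lemma total_variation_superadditive:
  assumes v: "signed_measure v" and AB: "A \<inter> B = {}"
    and ne: "A \<in> sets borel" "B \<in> sets borel"
  shows "total_variation v A + total_variation v B \<le> total_variation v (A \<union> B)"
proof -
  define \<P> where "\<P> A = {P. finite P \<and> P \<subseteq> sets borel \<and> disjoint P \<and> \<Union>P = A}" for A :: "'a set"
  define s where "s P = (\<Sum>B\<in>P. ennreal \<bar>v B\<bar>)" for P
  \<comment> \<open>Moving a summand into a supremum needs a nonempty family. Measurability of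
    \<open>A\<close> and \<open>B\<close> supplies it through the one-block partitions.\<close>
  have nonempty: "\<P> A \<noteq> {}" "\<P> B \<noteq> {}"
  proof -
    have "{A} \<in> \<P> A" "{B} \<in> \<P> B"
      using ne by (simp_all add: \<P>_def)
    then show "\<P> A \<noteq> {}" "\<P> B \<noteq> {}"
      by blast+
  qed
  have *: "s P + s Q \<le> total_variation v (A \<union> B)" if "P \<in> \<P> A" "Q \<in> \<P> B" for P Q
  proof -
    have "\<Union>P = A" "\<Union>Q = B"
      using that by (simp_all add: \<P>_def)
    \<comment> \<open>Partitions may contain the empty block, so \<open>P\<close> and
      \<open>Q\<close> need not be disjoint; the shared block contributes
      \<open>v {} = 0\<close>.\<close>
    then have "P \<inter> Q \<subseteq> {{}}"
      using AB by blast
    then have "s (P \<inter> Q) = 0"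
      by (metis (no_types, lifting) abs_zero ennreal_0 s_def signed_measure_empty[OF v]
          singletonD subsetD sum.neutral)
    moreover have "s (P \<union> Q) + s (P \<inter> Q) = s P + s Q"
      unfolding s_def using that by (intro sum.union_inter) (auto simp: \<P>_def)
    ultimately have "s P + s Q = s (P \<union> Q)"
      by simp
    also have "\<dots> \<le> total_variation v (A \<union> B)"
      unfolding s_def using that \<open>\<Union>P = A\<close> \<open>\<Union>Q = B\<close> AB
      by (intro sum_le_total_variation disjoint_union) (simp_all add: \<P>_def)
    finally show ?thesis .
  qed
  have TV: "total_variation v C = (SUP P\<in>\<P> C. s P)" for C
    by (simp only: total_variation_def \<P>_def s_def)
  have "total_variation v A + total_variation v B = (SUP P\<in>\<P> A. s P + (SUP Q\<in>\<P> B. s Q))"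
    unfolding TV by (rule ennreal_SUP_add_left[symmetric]) (rule nonempty)
  also have "\<dots> = (SUP P\<in>\<P> A. SUP Q\<in>\<P> B. s P + s Q)"
    by (intro SUP_cong refl ennreal_SUP_add_right nonempty)
  also have "\<dots> \<le> total_variation v (A \<union> B)"
    by (intro SUP_least *)
  finally show ?thesis .
qed

lemma total_variation_mono:
  assumes "signed_measure v" "A \<subseteq> B" "A \<in> sets borel" "B \<in> sets borel"
  shows "total_variation v A \<le> total_variation v B"
proof -
  have "total_variation v A \<le> total_variation v A + total_variation v (B - A)"
    by simp
  also have "\<dots> \<le> total_variation v (A \<union> (B - A))"
    by (rule total_variation_superadditive) (use assms in auto)
  finally show ?thesis
    using assms by (simp add: Un_absorb1)
qed

text \<open>The triangle inequality for partial sums survives the limit. Working in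
  \<open>ennreal\<close> avoids having to know that the series on the right is finite.\<close>

lemma abs_signed_measure_le_suminf:
  assumes v: "signed_measure v" and A: "range A \<subseteq> sets borel" "disjoint_family A"
  shows "ennreal \<bar>v (\<Union>n. A n)\<bar> \<le> (\<Sum>n. ennreal \<bar>v (A n)\<bar>)"
proof (rule LIMSEQ_le_const2)
  show "(\<lambda>N. ennreal \<bar>\<Sum>n<N. v (A n)\<bar>) \<longlonglongrightarrow> ennreal \<bar>v (\<Union>n. A n)\<bar>"
    using signed_measure_sums[OF v A] unfolding sums_def
    by (intro tendsto_ennrealI tendsto_rabs)
  have "ennreal \<bar>\<Sum>n<N. v (A n)\<bar> \<le> (\<Sum>n. ennreal \<bar>v (A n)\<bar>)" for N
  proof -
    have "ennreal \<bar>\<Sum>n<N. v (A n)\<bar> \<le> ennreal (\<Sum>n<N. \<bar>v (A n)\<bar>)"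
      by (intro ennreal_leI sum_abs)
    also have "\<dots> = (\<Sum>n<N. ennreal \<bar>v (A n)\<bar>)"
      by (simp add: sum_ennreal)
    also have "\<dots> \<le> (\<Sum>n. ennreal \<bar>v (A n)\<bar>)"
      by (intro sum_le_suminf) auto
    finally show ?thesis .
  qed
  then show "\<exists>N\<^sub>0. \<forall>N\<ge>N\<^sub>0. ennreal \<bar>\<Sum>n<N. v (A n)\<bar> \<le> (\<Sum>n. ennreal \<bar>v (A n)\<bar>)"
    by auto
qed

text \<open>Each block of a partition of the union is cut along the sets \<open>A n\<close>; for
  fixed \<open>n\<close> the pieces form a partition of \<open>A n\<close>.\<close>

lemma total_variation_countably_subadditive:
  assumes v: "signed_measure v" and A: "range A \<subseteq> sets borel" "disjoint_family A"
  shows "total_variation v (\<Union>n. A n) \<le> (\<Sum>n. total_variation v (A n))"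
proof (rule total_variation_least)
  fix P assume P: "finite P" "P \<subseteq> sets borel" "disjoint P" "\<Union>P = (\<Union>n. A n)"
  have "(\<Sum>B\<in>P. ennreal \<bar>v B\<bar>) \<le> (\<Sum>B\<in>P. \<Sum>n. ennreal \<bar>v (B \<inter> A n)\<bar>)"
  proof (rule sum_mono)
    fix B assume B: "B \<in> P"
    then have "B = (\<Union>n. B \<inter> A n)"
      using P by auto
    moreover have "ennreal \<bar>v (\<Union>n. B \<inter> A n)\<bar> \<le> (\<Sum>n. ennreal \<bar>v (B \<inter> A n)\<bar>)"
      using A B P by (intro abs_signed_measure_le_suminf[OF v])
        (auto simp: disjoint_family_on_def)
    ultimately show "ennreal \<bar>v B\<bar> \<le> (\<Sum>n. ennreal \<bar>v (B \<inter> A n)\<bar>)"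
      by simp
  qed
  also have "\<dots> = (\<Sum>n. \<Sum>B\<in>P. ennreal \<bar>v (B \<inter> A n)\<bar>)"
    by (rule suminf_sum[symmetric]) simp
  also have "\<dots> \<le> (\<Sum>n. total_variation v (A n))"
  proof (intro suminf_le allI summableI)
    fix n
    \<comment> \<open>Different blocks can have the same trace on \<open>A n\<close> only if that
      trace is empty, where \<open>v\<close> vanishes. Replacing the family of traces by the set of
      traces thus loses nothing.\<close>
    have "(\<Sum>B\<in>P. ennreal \<bar>v (B \<inter> A n)\<bar>) = (\<Sum>B\<in>(\<lambda>B. B \<inter> A n) ` P. ennreal \<bar>v B\<bar>)"
    proof (subst sum.reindex_nontrivial)
      fix B C assume "B \<in> P" "C \<in> P" "B \<noteq> C" "B \<inter> A n = C \<inter> A n"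
      then have "B \<inter> A n = {}"
        using P(3) by (auto simp: disjoint_def)
      then show "ennreal \<bar>v (B \<inter> A n)\<bar> = 0"
        by (simp add: signed_measure_empty[OF v])
    qed (use P in auto)
    also have "\<dots> \<le> total_variation v (A n)"
    proof (rule sum_le_total_variation)
      show "disjoint ((\<lambda>B. B \<inter> A n) ` P)"
        using P(3) by (fastforce simp: disjoint_def)
      show "\<Union>((\<lambda>B. B \<inter> A n) ` P) = A n"
        using P(4) by auto
    qed (use P A in auto)
    finally show "(\<Sum>B\<in>P. ennreal \<bar>v (B \<inter> A n)\<bar>) \<le> total_variation v (A n)" .
  qed
  finally show "(\<Sum>B\<in>P. ennreal \<bar>v B\<bar>) \<le> (\<Sum>n. total_variation v (A n))" .
qed

lemma sum_total_variation_le: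
  assumes v: "signed_measure v" and A: "range A \<subseteq> sets borel" "disjoint_family A"
  shows "(\<Sum>n<N::nat. total_variation v (A n)) \<le> total_variation v (\<Union>n<N. A n)"
proof (induction N)
  case (Suc N)
  have "(\<Sum>n<Suc N. total_variation v (A n)) \<le>
      total_variation v (\<Union>n<N. A n) + total_variation v (A N)"
    using Suc by (simp add: add_right_mono)
  also have "\<dots> \<le> total_variation v ((\<Union>n<N. A n) \<union> A N)"
  proof (rule total_variation_superadditive[OF v])
    have "A n \<inter> A N = {}" if "n < N" for n
      using A(2) that by (simp add: disjoint_family_onD)
    then show "(\<Union>n<N. A n) \<inter> A N = {}"
      by blast
    have "A n \<in> sets borel" for n
      using A(1) by blast
    then show "(\<Union>n<N. A n) \<in> sets borel" "A N \<in> sets borel"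
      by (simp_all add: sets.finite_UN)
  qed
  also have "(\<Union>n<N. A n) \<union> A N = (\<Union>n<Suc N. A n)"
    by (auto simp: lessThan_Suc)
  finally show ?case .
qed simp

text \<open>Finite superadditivity and monotonicity bound all partial sums from above; countable
  subadditivity is the reverse inequality.\<close>

lemma countably_additive_total_variation:
  assumes v: "signed_measure v"
  shows "countably_additive (sets borel) (total_variation v)"
proof (rule countably_additiveI)
  fix A :: "nat \<Rightarrow> 'a set"
  assume A: "range A \<subseteq> sets borel" "disjoint_family A" "(\<Union>n. A n) \<in> sets borel"
  have "(\<Sum>n<N. total_variation v (A n)) \<le> total_variation v (\<Union>n. A n)" for N
  proof -
    have "(\<Sum>n<N. total_variation v (A n)) \<le> total_variation v (\<Union>n<N. A n)"
      by (rule sum_total_variation_le[OF v A(1,2)])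
    also have "\<dots> \<le> total_variation v (\<Union>n. A n)"
      by (rule total_variation_mono[OF v]) (use A in auto)
    finally show ?thesis .
  qed
  then show "(\<Sum>n. total_variation v (A n)) = total_variation v (\<Union>n. A n)"
    by (intro antisym suminf_le_const summableI
        total_variation_countably_subadditive[OF v A(1,2)])
qed

section \<open>The variation measure and the Jordan parts\<close>

lemma sets_borel_sigma_algebra: "sigma_algebra UNIV (sets borel)"
  using sets.sigma_algebra_axioms[of borel] by simp

lemma sets_variation_measure [simp, measurable_cong]: "sets (variation_measure v) = sets borel"
  unfolding variation_measure_def
  using sigma_algebra.sets_measure_of_eq[OF sets_borel_sigma_algebra] by blast

lemma emeasure_variation_measure:
  assumes "signed_measure v" "A \<in> sets borel"
  shows "emeasure (variation_measure v) A = total_variation v A"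
  unfolding variation_measure_def
  by (rule emeasure_measure_of_sigma[OF sets_borel_sigma_algebra])
    (use assms in \<open>auto simp: positive_def total_variation_empty countably_additive_total_variation\<close>)

lemma abs_le_measure_variation:
  assumes "signed_measure v" "finite_measure (variation_measure v)" "A \<in> sets borel"
  shows "\<bar>v A\<bar> \<le> measure (variation_measure v) A"
proof -
  interpret finite_measure "variation_measure v" by fact
  have "ennreal \<bar>v A\<bar> \<le> emeasure (variation_measure v) A"
    using assms by (simp add: emeasure_variation_measure abs_le_total_variation)
  then show ?thesis
    by (simp add: emeasure_eq_measure)
qed

lemma signed_measure_uminus: "signed_measure v \<Longrightarrow> signed_measure (\<lambda>A. - v A)"
  by (auto simp: signed_measure_def sums_minus)

lemma total_variation_uminus: "total_variation (\<lambda>A. - v A) = total_variation v"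
  by (simp add: fun_eq_iff total_variation_def)

lemma variation_measure_uminus: "variation_measure (\<lambda>A. - v A) = variation_measure v"
  by (simp add: variation_measure_def total_variation_uminus)

text \<open>Negation preserves the total variation, so every fact about negative parts is a fact
  about positive parts of \<open>- v\<close>.\<close>

lemma negative_part_conv_positive_part: "negative_part v = positive_part (\<lambda>A. - v A)"
  by (simp add: negative_part_def positive_part_def total_variation_uminus)

lemma sets_positive_part [simp, measurable_cong]: "sets (positive_part v) = sets borel"
  unfolding positive_part_def
  using sigma_algebra.sets_measure_of_eq[OF sets_borel_sigma_algebra] by blast

text \<open>Countable additivity is inherited from the variation and from \<open>v\<close>. The
  bound of \<bar>v A\<bar> by the variation keeps the values nonnegative, so \<open>ennreal\<close>
  truncates nothing and the real series transfers.\<close>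

lemma emeasure_positive_part:
  assumes v: "signed_measure v" and fin: "finite_measure (variation_measure v)"
    and A: "A \<in> sets borel"
  shows "emeasure (positive_part v) A = ennreal ((measure (variation_measure v) A + v A) / 2)"
proof -
  interpret finite_measure "variation_measure v" by fact
  let ?f = "\<lambda>A. ennreal ((enn2real (total_variation v A) + v A) / 2)"
  have TV: "enn2real (total_variation v A) = measure (variation_measure v) A" if "A \<in> sets borel" for A
    using that v by (simp add: measure_def emeasure_variation_measure)
  have "countably_additive (sets borel) ?f"
  proof (rule countably_additiveI)
    fix A :: "nat \<Rightarrow> 'a set"
    assume A: "range A \<subseteq> sets borel" "disjoint_family A" "(\<Union>n. A n) \<in> sets borel"
    then have borel: "A n \<in> sets borel" for n by auto
    have "(\<lambda>n. measure (variation_measure v) (A n)) sums measure (variation_measure v) (\<Union>n. A n)"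
      by (rule finite_measure_UNION) (use A in auto)
    then have "(\<lambda>n. (measure (variation_measure v) (A n) + v (A n)) / 2)
        sums ((measure (variation_measure v) (\<Union>n. A n) + v (\<Union>n. A n)) / 2)"
      by (intro sums_divide sums_add signed_measure_sums[OF v] A)
    moreover have "0 \<le> (measure (variation_measure v) (A n) + v (A n)) / 2" for n
      using abs_le_measure_variation[OF v fin borel[of n]] by simp
    ultimately have "(\<Sum>n. ennreal ((measure (variation_measure v) (A n) + v (A n)) / 2)) =
        ennreal ((measure (variation_measure v) (\<Union>n. A n) + v (\<Union>n. A n)) / 2)"
      by (intro suminf_ennreal_eq)
    then show "(\<Sum>n. ?f (A n)) = ?f (\<Union>n. A n)"
      using TV[OF A(3)] TV[OF borel] by simp
  qed
  then have "emeasure (positive_part v) A = ?f A"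
    unfolding positive_part_def using A
    by (intro emeasure_measure_of_sigma[OF sets_borel_sigma_algebra])
      (auto simp: positive_def total_variation_empty signed_measure_empty v)
  then show ?thesis
    by (simp add: TV A)
qed

lemma measure_positive_part:
  assumes "signed_measure v" "finite_measure (variation_measure v)" "A \<in> sets borel"
  shows "measure (positive_part v) A = (measure (variation_measure v) A + v A) / 2"
  using emeasure_positive_part[OF assms] abs_le_measure_variation[OF assms]
  by (simp add: measure_def)

lemma finite_measure_positive_part:
  assumes "signed_measure v" "finite_measure (variation_measure v)"
  shows "finite_measure (positive_part v)"
  by (rule finite_measureI)
    (use emeasure_positive_part[OF assms] sets_eq_imp_space_eq[OF sets_positive_part[of v]] in simp)

lemma
  fixes f :: "'a::topological_space \<Rightarrow> real"
  assumes "finite_measure M" "sets M = sets borel" "f \<in> borel_measurable borel"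
    and "K \<in> sets borel" "U \<in> sets borel"
    and "\<And>x. 0 \<le> f x" "\<And>x. f x \<le> 1" "\<And>x. x \<in> K \<Longrightarrow> f x = 1" "\<And>x. x \<notin> U \<Longrightarrow> f x = 0"
  shows measure_le_integral_bump: "measure M K \<le> integral\<^sup>L M f"
    and integral_bump_le_measure: "integral\<^sup>L M f \<le> measure M U"
proof -
  interpret finite_measure M by fact
  have [measurable]: "K \<in> sets M" "U \<in> sets M"
    using assms by auto
  have "f \<in> borel_measurable M"
    using assms(3) measurable_cong_sets[OF assms(2) refl] by blast
  then have int: "integrable M f"
    by (intro integrable_const_bound[of _ 1]) (use assms(6,7) in auto)
  have [simp]: "space M = UNIV"
    using sets_eq_imp_space_eq[OF assms(2)] by simp
  have "measure M K = (\<integral>x. indicator K x \<partial>M)"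
    by simp
  also have "\<dots> \<le> integral\<^sup>L M f"
    by (rule integral_mono) (use assms(6-9) int in \<open>auto split: split_indicator simp: emeasure_eq_measure\<close>)
  finally show "measure M K \<le> integral\<^sup>L M f" .
  have "integral\<^sup>L M f \<le> (\<integral>x. indicator U x \<partial>M)"
    by (rule integral_mono) (use assms(6-9) int in \<open>auto split: split_indicator simp: emeasure_eq_measure\<close>)
  also have "\<dots> = measure M U"
    by simp
  finally show "integral\<^sup>L M f \<le> measure M U" .
qed

text \<open>Each Jordan part integrates \<open>f\<close> to a value between its masses of
  \<open>K\<close> and \<open>U\<close>. The resulting errors are at most the masses of the two
  parts on \<open>U - K\<close>, and these masses add up to the variation.\<close>

lemma signed_integral_bump:
  fixes f :: "'a::topological_space \<Rightarrow> real"
  assumes v: "signed_measure v" "finite_measure (variation_measure v)"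
    and f: "f \<in> borel_measurable borel" and KU: "K \<in> sets borel" "U \<in> sets borel" "K \<subseteq> U"
    and f01: "\<And>x. 0 \<le> f x" "\<And>x. f x \<le> 1" "\<And>x. x \<in> K \<Longrightarrow> f x = 1" "\<And>x. x \<notin> U \<Longrightarrow> f x = 0"
  shows "\<bar>signed_integral v f - v K\<bar> \<le> measure (variation_measure v) (U - K)"
proof -
  interpret finite_measure "variation_measure v" by fact
  let ?m = "measure (variation_measure v)"
  note v' = signed_measure_uminus[OF v(1)] v(2)[folded variation_measure_uminus[of v]]
  note fin = finite_measure_positive_part[OF v] finite_measure_positive_part[OF v']
  note bounds = measure_le_integral_bump[OF fin(1) _ f KU(1,2) f01]
    integral_bump_le_measure[OF fin(1) _ f KU(1,2) f01]
    measure_le_integral_bump[OF fin(2) _ f KU(1,2) f01]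
    integral_bump_le_measure[OF fin(2) _ f KU(1,2) f01]
  have "?m (U - K) = ?m U - ?m K"
    by (rule finite_measure_Diff) (use KU in auto)
  with bounds show ?thesis
    unfolding signed_integral_def negative_part_conv_positive_part
    using measure_positive_part[OF v] measure_positive_part[OF v'] KU
    by (simp add: variation_measure_uminus)
qed

section \<open>Finite positive measures as signed measures\<close>

lemma signed_measure_measure:
  assumes "finite_measure M" "sets M = sets borel"
  shows "signed_measure (measure M)"
proof -
  interpret finite_measure M by fact
  show ?thesis
    using assms(2) unfolding signed_measure_def
    by (auto simp: measure_notin_sets intro!: finite_measure_UNION)
qed

text \<open>Without cancellation every finite Borel partition of \<open>A\<close> yields exactly the
  mass of \<open>A\<close>, so the supremum is over a constant.\<close>

lemma variation_measure_measure:
  assumes "finite_measure M" "sets M = sets borel"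
  shows "variation_measure (measure M) = M"
proof (rule measure_eqI)
  interpret finite_measure M by fact
  fix A assume "A \<in> sets (variation_measure (measure M))"
  then have A: "A \<in> sets borel" by simp
  have sum: "(\<Sum>B\<in>P. ennreal \<bar>measure M B\<bar>) = emeasure M (\<Union>P)"
    if "finite P" "P \<subseteq> sets borel" "disjoint P" for P
  proof -
    have "(\<Sum>B\<in>P. emeasure M (id B)) = emeasure M (\<Union>B\<in>P. id B)"
      by (rule sum_emeasure)
        (use that assms in \<open>auto simp: disjoint_def disjoint_family_on_def\<close>)
    then show ?thesis
      by (simp add: emeasure_eq_measure)
  qed
  have "total_variation (measure M) A = emeasure M A"
  proof (rule antisym)
    show "total_variation (measure M) A \<le> emeasure M A"
      by (rule total_variation_least) (metis sum order_refl)
    show "emeasure M A \<le> total_variation (measure M) A"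
      using abs_le_total_variation[of A A "measure M"] A by (simp add: emeasure_eq_measure)
  qed
  then show "emeasure (variation_measure (measure M)) A = emeasure M A"
    using emeasure_variation_measure[OF signed_measure_measure[OF assms] A] by simp
qed (simp add: assms)

text \<open>Since the variation is \<open>M\<close> itself, the Jordan parts are \<open>M\<close>
  and the zero measure.\<close>

lemma signed_integral_measure:
  assumes "finite_measure M" "sets M = sets borel"
  shows "signed_integral (measure M) f = integral\<^sup>L M f"
proof -
  interpret finite_measure M by fact
  note v = signed_measure_measure[OF assms]
  note var = variation_measure_measure[OF assms]
  have fin: "finite_measure (variation_measure (measure M))"
    "finite_measure (variation_measure (\<lambda>A. - measure M A))"
    using assms by (simp_all add: variation_measure_uminus var)
  have "positive_part (measure M) = M"
    by (rule measure_eqI)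
      (simp_all add: assms emeasure_positive_part[OF v fin(1)] var emeasure_eq_measure)
  moreover have "negative_part (measure M) = null_measure borel"
    unfolding negative_part_conv_positive_part
    by (rule measure_eqI) (simp_all add: variation_measure_uminus var
        emeasure_positive_part[OF signed_measure_uminus[OF v] fin(2)])
  ultimately show ?thesis
    by (simp add: signed_integral_def)
qed

section \<open>Regularity on compact Hausdorff spaces\<close>

lemma compact_imp_borel: "compact (K :: 'a::t2_space set) \<Longrightarrow> K \<in> sets borel"
  by (intro borel_closed compact_imp_closed)

lemma radon_imp_finite_measure:
  assumes "compact (UNIV :: 'a::t2_space set)" "radon_measure (M :: 'a measure)"
  shows "finite_measure M"
proof (rule finite_measureI)
  have "space M = UNIV"
    using assms by (metis radon_measure_def sets_eq_imp_space_eq space_borel)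
  moreover have "emeasure M UNIV < \<infinity>"
    using assms unfolding radon_measure_def by blast
  ultimately show "emeasure M (space M) \<noteq> \<infinity>"
    by simp
qed

lemma radon_inner_approx:
  fixes M :: "'a::t2_space measure"
  assumes "finite_measure M" "radon_measure M" "A \<in> sets borel" "e > 0"
  obtains K where "compact K" "K \<subseteq> A" "measure M (A - K) < e"
proof -
  interpret finite_measure M by fact
  have sets: "sets M = sets borel"
    using assms by (simp add: radon_measure_def)
  have "\<exists>K. compact K \<and> K \<subseteq> A \<and> measure M A - e < measure M K"
  proof (rule ccontr)
    assume neg: "\<not> ?thesis"
    have *: "measure M K \<le> measure M A - e" if "compact K" "K \<subseteq> A" for K
      using neg that by (meson not_less)
    have "emeasure M A = (SUP K\<in>{K. compact K \<and> K \<subseteq> A}. emeasure M K)"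
      using assms by (simp add: radon_measure_def)
    also have "\<dots> \<le> ennreal (measure M A - e)"
      by (intro SUP_least) (auto simp: emeasure_eq_measure intro!: ennreal_leI *)
    \<comment> \<open>The choice \<open>K = {}\<close> shows that \<open>measure M A - e\<close> is
      nonnegative, so \<open>ennreal\<close> does not truncate it and the bound contradicts
      \<open>e > 0\<close>.\<close>
    finally show False
      using *[of "{}"] \<open>e > 0\<close> by (simp add: emeasure_eq_measure)
  qed
  then obtain K where K: "compact K" "K \<subseteq> A" "measure M A - e < measure M K"
    by blast
  moreover have "measure M (A - K) = measure M A - measure M K"
    by (rule finite_measure_Diff) (use assms K sets compact_imp_borel in auto)
  ultimately show thesis
    by (intro that[of K]) auto
qed

text \<open>Inner approximation of the complement: the complement of a compact subset of
  \<open>- K\<close> is an open neighbourhood of \<open>K\<close>.\<close>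

lemma radon_outer_approx:
  fixes M :: "'a::t2_space measure"
  assumes "finite_measure M" "radon_measure M" "compact K" "e > 0"
  obtains U where "open U" "K \<subseteq> U" "measure M (U - K) < e"
proof -
  have "- K \<in> sets borel"
    by (intro borel_comp compact_imp_borel assms)
  then obtain L where L: "compact L" "L \<subseteq> - K" "measure M (- K - L) < e"
    by (rule radon_inner_approx[OF assms(1,2) _ assms(4)])
  show thesis
  proof (rule that)
    show "open (- L)"
      using L(1) by (simp add: compact_imp_closed open_Compl)
    show "K \<subseteq> - L" using L(2) by auto
    have "- L - K = - K - L" by auto
    with L(3) show "measure M (- L - K) < e" by simp
  qed
qed

lemma radon_measureI:
  fixes M :: "'a::t2_space measure"
  assumes "finite_measure M" "sets M = sets borel"
    and "\<And>A e. A \<in> sets borel \<Longrightarrow> e > 0 \<Longrightarrow> \<exists>K. compact K \<and> K \<subseteq> A \<and> measure M (A - K) < e"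
  shows "radon_measure M"
proof -
  interpret finite_measure M by fact
  have "emeasure M A = (SUP K\<in>{K. compact K \<and> K \<subseteq> A}. emeasure M K)" (is "_ = ?S")
    if A: "A \<in> sets borel" for A
  proof (rule antisym)
    show "?S \<le> emeasure M A"
      by (intro SUP_least emeasure_mono) (use A assms(2) in auto)
    show "emeasure M A \<le> ?S"
    proof (rule ennreal_le_epsilon)
      fix e :: real assume "e > 0"
      then obtain K where K: "compact K" "K \<subseteq> A" "measure M (A - K) < e"
        using assms(3)[OF A] by blast
      have "measure M (A - K) = measure M A - measure M K"
        by (rule finite_measure_Diff) (use assms K A compact_imp_borel in auto)
      with K have "measure M A \<le> measure M K + e" by simp
      then have "emeasure M A \<le> emeasure M K + ennreal e"
        using \<open>e > 0\<close> by (simp add: emeasure_eq_measure flip: ennreal_plus)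
      also have "emeasure M K \<le> ?S"
        using K by (intro SUP_upper) auto
      finally show "emeasure M A \<le> ?S + ennreal e"
        by (simp add: add_right_mono)
    qed
  qed
  moreover have "emeasure M K < \<infinity>" for K
    using emeasure_finite[of K] by (simp add: less_top[symmetric])
  ultimately show ?thesis
    using assms(2) by (simp add: radon_measure_def)
qed

section \<open>Urysohn functions and uniqueness of representing measures\<close>

lemma compact_continuous_bcontfun:
  fixes f :: "'a::topological_space \<Rightarrow> 'b::metric_space"
  assumes "compact (UNIV :: 'a set)" "continuous_on UNIV f"
  shows "f \<in> bcontfun"
  using compact_continuous_image[OF assms(2,1)] assms(2)
  by (simp add: bcontfun_def compact_imp_bounded)

text \<open>A compact Hausdorff space is normal, so the disjoint closed sets \<open>- U\<close> and
  \<open>K\<close> can be separated by a continuous function.\<close>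

lemma Urysohn_compact:
  fixes K U :: "'a::t2_space set"
  assumes UNIV: "compact (UNIV :: 'a set)" and KU: "compact K" "open U" "K \<subseteq> U"
  obtains f :: "'a \<Rightarrow>\<^sub>C real" where
    "\<And>x. 0 \<le> apply_bcontfun f x" "\<And>x. apply_bcontfun f x \<le> 1"
    "\<And>x. x \<in> K \<Longrightarrow> apply_bcontfun f x = 1" "\<And>x. x \<notin> U \<Longrightarrow> apply_bcontfun f x = 0"
proof -
  have "Hausdorff_space (euclidean :: 'a topology)"
    unfolding Hausdorff_space_def by (simp add: disjnt_def) (metis hausdorff)
  then have "normal_space (euclidean :: 'a topology)"
    by (intro compact_Hausdorff_or_regular_imp_normal_space disjI1)
      (use UNIV in \<open>simp add: compact_space_def\<close>)
  moreover have "closedin euclidean (- U)" "closedin euclidean K" "disjnt (- U) K"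
    using KU by (auto simp: compact_imp_closed disjnt_def)
  ultimately obtain f where f: "continuous_map euclidean (top_of_set {0..1::real}) f"
    "f ` (- U) \<subseteq> {0}" "f ` K \<subseteq> {1}"
    by (rule Urysohn_lemma[where a=0 and b=1]) auto
  then have "continuous_on UNIV f" "\<And>x. f x \<in> {0..1}"
    by (auto simp: continuous_map_in_subtopology)
  moreover from this have "f \<in> bcontfun"
    by (intro compact_continuous_bcontfun UNIV)
  ultimately show thesis
    using f(2,3) by (intro that[of "Bcontfun f"]) (auto simp: Bcontfun_inverse)
qed

text \<open>This is the uniqueness half of the Riesz representation theorem. For compact
  \<open>K\<close>, a bump function supported in a neighbourhood that is tight for both variations
  computes \<open>v K\<close> and \<open>w K\<close> up to small errors. Inner regularity of both
  variations extends the equality to Borel sets; elsewhere both functions are 0 by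
  convention.\<close>

lemma signed_radon_measure_eqI:
  fixes v w :: "'a::t2_space set \<Rightarrow> real"
  assumes UNIV: "compact (UNIV :: 'a set)"
    and v: "signed_radon_measure v" and w: "signed_radon_measure w"
    and eq: "\<And>f. signed_integral v (apply_bcontfun f) = signed_integral w (apply_bcontfun f)"
  shows "v = w"
proof
  let ?V = "variation_measure v" and ?W = "variation_measure w"
  have sm: "signed_measure v" "signed_measure w" and radon: "radon_measure ?V" "radon_measure ?W"
    using v w by (simp_all add: signed_radon_measure_def)
  have fin: "finite_measure ?V" "finite_measure ?W"
    by (rule radon_imp_finite_measure[OF UNIV]; fact)+
  interpret V: finite_measure ?V by fact
  interpret W: finite_measure ?W by fact
  have compact: "v K = w K" if K: "compact K" for K
  proof -
    have "\<bar>v K - w K\<bar> \<le> e" if "e > 0" for e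
    proof -
      from \<open>e > 0\<close> have "e / 2 > 0" by simp
      obtain U1 where U1: "open U1" "K \<subseteq> U1" "measure ?V (U1 - K) < e / 2"
        by (rule radon_outer_approx[OF fin(1) radon(1) K \<open>e / 2 > 0\<close>])
      obtain U2 where U2: "open U2" "K \<subseteq> U2" "measure ?W (U2 - K) < e / 2"
        by (rule radon_outer_approx[OF fin(2) radon(2) K \<open>e / 2 > 0\<close>])
      define U where "U = U1 \<inter> U2"
      have U: "open U" "K \<subseteq> U" using U1 U2 by (auto simp: U_def)
      have borel: "K \<in> sets borel" "U \<in> sets borel" "U1 \<in> sets borel" "U2 \<in> sets borel"
        using K U U1 U2 by (auto intro: compact_imp_borel)
      obtain f :: "'a \<Rightarrow>\<^sub>C real" where f:
        "\<And>x. 0 \<le> apply_bcontfun f x" "\<And>x. apply_bcontfun f x \<le> 1"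
        "\<And>x. x \<in> K \<Longrightarrow> apply_bcontfun f x = 1" "\<And>x. x \<notin> U \<Longrightarrow> apply_bcontfun f x = 0"
        using Urysohn_compact[OF UNIV K U] by metis
      have meas: "apply_bcontfun f \<in> borel_measurable borel"
        by (intro borel_measurable_continuous_onI) simp
      have "measure ?V (U - K) \<le> measure ?V (U1 - K)"
        by (rule V.finite_measure_mono) (use borel in \<open>auto simp: U_def\<close>)
      moreover have "measure ?W (U - K) \<le> measure ?W (U2 - K)"
        by (rule W.finite_measure_mono) (use borel in \<open>auto simp: U_def\<close>)
      ultimately show ?thesis
        using signed_integral_bump[OF sm(1) fin(1) meas borel(1,2) U(2) f]
          signed_integral_bump[OF sm(2) fin(2) meas borel(1,2) U(2) f]
          U1(3) U2(3) eq[of f] by linarith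
    qed
    then have "\<bar>v K - w K\<bar> \<le> 0"
      by (rule field_le_epsilon) simp
    then show ?thesis by simp
  qed
  fix A
  show "v A = w A"
  proof (cases "A \<in> sets borel")
    case True
    have "\<bar>v A - w A\<bar> \<le> e" if "e > 0" for e
    proof -
      from \<open>e > 0\<close> have "e / 2 > 0" by simp
      obtain K1 where K1: "compact K1" "K1 \<subseteq> A" "measure ?V (A - K1) < e / 2"
        by (rule radon_inner_approx[OF fin(1) radon(1) True \<open>e / 2 > 0\<close>])
      obtain K2 where K2: "compact K2" "K2 \<subseteq> A" "measure ?W (A - K2) < e / 2"
        by (rule radon_inner_approx[OF fin(2) radon(2) True \<open>e / 2 > 0\<close>])
      define K where "K = K1 \<union> K2"
      have K: "compact K" "K \<subseteq> A" using K1 K2 by (auto simp: K_def)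
      have borel: "K \<in> sets borel" "K1 \<in> sets borel" "K2 \<in> sets borel"
        using K K1 K2 by (auto intro: compact_imp_borel)
      have "measure ?V (A - K) \<le> measure ?V (A - K1)"
        by (rule V.finite_measure_mono) (use borel True in \<open>auto simp: K_def\<close>)
      moreover have "measure ?W (A - K) \<le> measure ?W (A - K2)"
        by (rule W.finite_measure_mono) (use borel True in \<open>auto simp: K_def\<close>)
      ultimately show ?thesis
        using signed_measure_diff[OF sm(1) True borel(1) K(2)]
          signed_measure_diff[OF sm(2) True borel(1) K(2)] compact[OF K(1)]
          abs_le_measure_variation[OF sm(1) fin(1), of "A - K"]
          abs_le_measure_variation[OF sm(2) fin(2), of "A - K"] borel True K1(3) K2(3)
        by (simp add: sets.Diff)
    qed
    then have "\<bar>v A - w A\<bar> \<le> 0"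
      by (rule field_le_epsilon) simp
    then show ?thesis by simp
  qed (simp add: signed_measure_not_borel sm)
qed

section \<open>Continuous kernels on compact spaces\<close>

lemma space_borel_measure: "sets M = sets borel \<Longrightarrow> space M = UNIV"
  by (metis sets_eq_imp_space_eq space_borel)

lemma integrable_continuous_compact:
  fixes f :: "'a::topological_space \<Rightarrow> real"
  assumes "compact (UNIV :: 'a set)" "finite_measure M" "sets M = sets borel" "continuous_on UNIV f"
  shows "integrable M f"
proof -
  interpret finite_measure M by fact
  have "bounded (range f)"
    by (intro compact_imp_bounded compact_continuous_image assms)
  then obtain B where "\<And>x. norm (f x) \<le> B"
    by (auto simp: bounded_iff)
  moreover have "f \<in> borel_measurable M"
    using borel_measurable_continuous_onI[OF assms(4)] measurable_cong_sets[OF assms(3) refl] by blast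
  ultimately show ?thesis
    by (intro integrable_const_bound[of _ B]) auto
qed

lemma (in finite_measure) abs_integral_le_bound:
  fixes f :: "'a \<Rightarrow> real"
  assumes "integrable M f" "\<And>x. x \<in> space M \<Longrightarrow> \<bar>f x\<bar> \<le> B"
  shows "\<bar>integral\<^sup>L M f\<bar> \<le> B * measure M (space M)"
proof -
  have "\<bar>integral\<^sup>L M f\<bar> \<le> (\<integral>x. \<bar>f x\<bar> \<partial>M)"
    by (rule integral_abs_bound)
  also have "\<dots> \<le> (\<integral>x. B \<partial>M)"
    by (rule integral_mono) (use assms in auto)
  also have "\<dots> = B * measure M (space M)"
    by simp
  finally show ?thesis .
qed

lemma continuous_slice:
  fixes f :: "'a::topological_space \<times> 'b::topological_space \<Rightarrow> 'c::topological_space"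
  assumes "continuous_on UNIV f"
  shows "continuous_on UNIV (\<lambda>y. f (x, y))" "continuous_on UNIV (\<lambda>x. f (x, y))"
    "continuous_on UNIV (\<lambda>(y, x). f (x, y))"
  unfolding case_prod_beta
  by (rule continuous_on_compose2[OF assms]; auto intro!: continuous_intros)+

text \<open>Compactness of the integration space makes nearby slices uniformly close, and finite
  mass turns this into closeness of their integrals.\<close>

lemma continuous_parametric_integral:
  fixes f :: "'a::topological_space \<times> 'b::topological_space \<Rightarrow> real"
  assumes UNIV: "compact (UNIV :: 'b set)" and M: "finite_measure M" "sets M = sets borel"
    and f: "continuous_on UNIV f"
  shows "continuous_on UNIV (\<lambda>x. \<integral>y. f (x, y) \<partial>M)"
  unfolding continuous_on_def
proof (intro ballI tendstoI)
  fix x\<^sub>0 :: 'a and e :: real assume "e > 0"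
  interpret finite_measure M by fact
  have space: "space M = UNIV"
    by (rule space_borel_measure[OF M(2)])
  have int: "integrable M (\<lambda>y. f (x, y))" for x
    by (intro integrable_continuous_compact UNIV M continuous_slice f)
  \<comment> \<open>The \<open>+ 1\<close> covers the zero measure and makes
    \<open>d * measure M UNIV < e\<close> strict.\<close>
  define d where "d = e / (measure M UNIV + 1)"
  have pos: "measure M UNIV + 1 > 0"
    using measure_nonneg[of M UNIV] by linarith
  then have d: "d > 0" "d * measure M UNIV < e"
    using \<open>e > 0\<close> by (auto simp: d_def field_simps)
  obtain X where X: "x\<^sub>0 \<in> X" "open X" "\<forall>x\<in>X \<inter> UNIV. \<forall>y\<in>UNIV. dist (f (x, y)) (f (x\<^sub>0, y)) \<le> d"
    by (rule continuous_on_prod_compactE[of UNIV UNIV f x\<^sub>0 d]) (use f UNIV d in auto)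
  have "dist (\<integral>y. f (x, y) \<partial>M) (\<integral>y. f (x\<^sub>0, y) \<partial>M) < e" if "x \<in> X" for x
  proof -
    have "dist (\<integral>y. f (x, y) \<partial>M) (\<integral>y. f (x\<^sub>0, y) \<partial>M) = \<bar>\<integral>y. f (x, y) - f (x\<^sub>0, y) \<partial>M\<bar>"
      by (simp add: dist_real_def int)
    also have "\<dots> \<le> d * measure M (space M)"
      using X(3) that by (intro abs_integral_le_bound) (auto simp: int dist_real_def)
    finally show ?thesis
      using d(2) by (simp add: space)
  qed
  then show "\<forall>\<^sub>F x in at x\<^sub>0 within UNIV. dist (\<integral>y. f (x, y) \<partial>M) (\<integral>y. f (x\<^sub>0, y) \<partial>M) < e"
    using X(1,2) by (auto simp: eventually_at_topological)
qed

text \<open>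
  Without second countability the Borel sets of a product are not generated by rectangles.
  Slices of a continuous function depend uniformly continuously on the parameter, which
  nevertheless makes it a uniform limit of functions that are piecewise slices over a finite
  Borel partition.
\<close>

lemma borel_measurable_pair_continuous:
  fixes f :: "'a::topological_space \<times> 'b::topological_space \<Rightarrow> real"
  assumes UNIV: "compact (UNIV :: 'a set)" "compact (UNIV :: 'b set)" and f: "continuous_on UNIV f"
  shows "f \<in> borel_measurable (borel \<Otimes>\<^sub>M borel)"
proof -
  have approx: "\<exists>g \<in> borel_measurable (borel \<Otimes>\<^sub>M borel). \<forall>p. dist (g p) (f p) \<le> e"
    if "e > 0" for e :: real
  proof -
    have "\<exists>X. x \<in> X \<and> open X \<and> (\<forall>z\<in>X. \<forall>y. dist (f (z, y)) (f (x, y)) \<le> e)" for x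
      by (rule continuous_on_prod_compactE[of UNIV UNIV f x e]) (use f UNIV that in auto)
    then obtain X where X: "\<And>x. x \<in> X x" "\<And>x. open (X x)"
      "\<And>x z y. z \<in> X x \<Longrightarrow> dist (f (z, y)) (f (x, y)) \<le> e"
      by metis
    obtain D where D: "finite D" "UNIV \<subseteq> (\<Union>x\<in>D. X x)"
      by (rule compactE_image[OF UNIV(1), of UNIV X]) (use X in auto)
    have "\<exists>g \<in> borel_measurable (borel \<Otimes>\<^sub>M borel). \<forall>x\<in>(\<Union>x\<in>D. X x). \<forall>y. dist (g (x, y)) (f (x, y)) \<le> e"
      using D(1)
    proof induction
      case empty
      show ?case by (rule bexI[of _ "\<lambda>_. 0"]) simp_all
    next
      case (insert d D)
      then obtain g where g[measurable]: "g \<in> borel_measurable (borel \<Otimes>\<^sub>M borel)"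
        and *: "\<And>z x y. z \<in> D \<Longrightarrow> x \<in> X z \<Longrightarrow> dist (g (x, y)) (f (x, y)) \<le> e"
        by blast
      have [measurable]: "X d \<in> sets borel"
        using X(2) by auto
      have [measurable]: "(\<lambda>y. f (d, y)) \<in> borel_measurable borel"
        by (intro borel_measurable_continuous_onI continuous_slice f)
      \<comment> \<open>On \<open>X d\<close> the new slice overrides \<open>g\<close>, which makes
        the overlapping cover into disjoint pieces without naming a partition.\<close>
      have "(\<lambda>p. if fst p \<in> X d then f (d, snd p) else g p) \<in> borel_measurable (borel \<Otimes>\<^sub>M borel)"
        by measurable
      then show ?case
        by (rule bexI[rotated]) (use X(3)[of _ d] * in \<open>auto simp: dist_commute[of "f (d, _)"]\<close>)
    qed
    with D(2) show ?thesis
      by (metis UNIV_I subsetD surj_pair)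
  qed
  have "\<forall>n. \<exists>g. g \<in> borel_measurable (borel \<Otimes>\<^sub>M borel) \<and> (\<forall>p. dist (g p) (f p) \<le> 1 / real (Suc n))"
    using approx[of "1 / real (Suc n)" for n] by (simp add: Bex_def)
  then obtain g where g: "\<And>n. g n \<in> borel_measurable (borel \<Otimes>\<^sub>M borel)"
    "\<And>n p. dist (g n p) (f p) \<le> 1 / real (Suc n)"
    by metis
  show ?thesis
  proof (rule borel_measurable_LIMSEQ_metric)
    fix p
    have "(\<lambda>n. dist (g n p) (f p)) \<longlonglongrightarrow> 0"
      by (rule tendsto_sandwich[OF _ _ tendsto_const lim_1_over_n[THEN LIMSEQ_Suc]])
        (use g(2) in auto)
    then show "(\<lambda>n. g n p) \<longlonglongrightarrow> f p"
      by (rule tendsto_dist_iff[THEN iffD2])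
  qed (rule g)
qed

text \<open>Joint measurability for the product sigma-algebra is the delicate point; integrability
  then follows from boundedness and finite total mass.\<close>

lemma Fubini_continuous_compact:
  fixes f :: "'a::topological_space \<times> 'b::topological_space \<Rightarrow> real"
  assumes UNIV: "compact (UNIV :: 'a set)" "compact (UNIV :: 'b set)" and f: "continuous_on UNIV f"
    and M: "finite_measure M" "sets M = sets borel" and N: "finite_measure N" "sets N = sets borel"
  shows "(\<integral>y. \<integral>x. f (x, y) \<partial>M \<partial>N) = (\<integral>x. \<integral>y. f (x, y) \<partial>N \<partial>M)"
proof -
  interpret M: finite_measure M by fact
  interpret N: finite_measure N by fact
  interpret pair_sigma_finite M N ..
  interpret MN: finite_measure "M \<Otimes>\<^sub>M N"
    by (rule finite_measure_pair_measure) fact+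
  have "sets (M \<Otimes>\<^sub>M N) = sets (borel \<Otimes>\<^sub>M borel)"
    by (rule sets_pair_measure_cong[OF M(2) N(2)])
  then have meas: "f \<in> borel_measurable (M \<Otimes>\<^sub>M N)"
    using borel_measurable_pair_continuous[OF UNIV f] measurable_cong_sets[OF _ refl] by blast
  have "bounded (f ` (UNIV \<times> UNIV))"
    by (intro compact_imp_bounded compact_continuous_image compact_Times UNIV) (use f in simp)
  then obtain B where "\<And>p. norm (f p) \<le> B"
    by (auto simp: bounded_iff)
  then have "integrable (M \<Otimes>\<^sub>M N) f"
    by (intro MN.integrable_const_bound[of _ B] meas) auto
  then show ?thesis
    using Fubini_integral[of "\<lambda>x y. f (x, y)"] by simp
qed

section \<open>Measures with a continuous density\<close>

lemma
  fixes \<mu> :: "'a::t2_space measure" and h :: "'a \<Rightarrow> real"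
  assumes UNIV: "compact (UNIV :: 'a set)" and \<mu>: "finite_measure \<mu>" "sets \<mu> = sets borel"
    and h: "continuous_on UNIV h" "\<And>x. 0 \<le> h x"
  shows measure_continuous_density:
      "A \<in> sets borel \<Longrightarrow> measure (density \<mu> h) A = (\<integral>x. h x * indicator A x \<partial>\<mu>)"
    and finite_measure_continuous_density: "finite_measure (density \<mu> h)"
    and integral_continuous_density:
      "continuous_on UNIV f \<Longrightarrow> integral\<^sup>L (density \<mu> h) f = (\<integral>x. h x * f x \<partial>\<mu>)"
proof -
  interpret finite_measure \<mu> by fact
  have meas: "g \<in> borel_measurable \<mu>" if "continuous_on UNIV g" for g :: "'a \<Rightarrow> real"
    using borel_measurable_continuous_onI[OF that] measurable_cong_sets[OF \<mu>(2) refl] by blast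
  note [measurable] = meas[OF h(1)]
  have int: "integrable \<mu> (\<lambda>x. h x * indicator A x)" if "A \<in> sets borel" for A
    by (intro integrable_real_mult_indicator integrable_continuous_compact UNIV \<mu> h)
      (use that \<mu>(2) in simp)
  have em: "emeasure (density \<mu> h) A = ennreal (\<integral>x. h x * indicator A x \<partial>\<mu>)"
    if A: "A \<in> sets borel" for A
  proof -
    have "emeasure (density \<mu> h) A = (\<integral>\<^sup>+x. ennreal (h x) * indicator A x \<partial>\<mu>)"
      by (rule emeasure_density) (use A \<mu>(2) in auto)
    also have "\<dots> = (\<integral>\<^sup>+x. ennreal (h x * indicator A x) \<partial>\<mu>)"
      by (intro nn_integral_cong) (simp split: split_indicator)
    also have "\<dots> = ennreal (\<integral>x. h x * indicator A x \<partial>\<mu>)"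
      by (intro nn_integral_eq_integral int A AE_I2) (simp add: h)
    finally show ?thesis .
  qed
  show "measure (density \<mu> h) A = (\<integral>x. h x * indicator A x \<partial>\<mu>)" if "A \<in> sets borel"
    using em[OF that] by (simp add: measure_def h)
  show "finite_measure (density \<mu> h)"
    by (rule finite_measureI) (use em[of UNIV] in \<open>simp add: space_borel_measure \<mu>\<close>)
  show "integral\<^sup>L (density \<mu> h) f = (\<integral>x. h x * f x \<partial>\<mu>)" if "continuous_on UNIV f"
    using integral_density[of f \<mu> h] meas[OF that] h(2) by simp
qed

text \<open>A bound \<open>B\<close> of the density makes the new measure at most \<open>B\<close>
  times \<mu>, so compact sets approximating for \<mu> also approximate for the new measure.\<close>

lemma radon_measure_continuous_density:
  fixes \<mu> :: "'a::t2_space measure" and h :: "'a \<Rightarrow> real"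
  assumes UNIV: "compact (UNIV :: 'a set)" and \<mu>: "radon_measure \<mu>"
    and h: "continuous_on UNIV h" "\<And>x. 0 \<le> h x"
  shows "radon_measure (density \<mu> h)"
proof -
  have fin: "finite_measure \<mu>" and sets: "sets \<mu> = sets borel"
    using radon_imp_finite_measure[OF UNIV \<mu>] \<mu> by (simp_all add: radon_measure_def)
  interpret finite_measure \<mu> by fact
  note density = measure_continuous_density[OF UNIV fin sets h]
  have "bounded (range h)"
    by (intro compact_imp_bounded compact_continuous_image UNIV h)
  then obtain B where B: "\<And>x. \<bar>h x\<bar> \<le> B"
    by (auto simp: bounded_iff)
  have "0 \<le> B"
    using B abs_ge_zero order_trans by blast
  have le: "measure (density \<mu> h) A \<le> B * measure \<mu> A" if A: "A \<in> sets borel" for A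
  proof -
    have "(\<integral>x. h x * indicator A x \<partial>\<mu>) \<le> (\<integral>x. B * indicator A x \<partial>\<mu>)"
    proof (rule integral_mono)
      show "integrable \<mu> (\<lambda>x. h x * indicator A x)"
        by (intro integrable_real_mult_indicator integrable_continuous_compact UNIV fin sets h)
          (use A sets in simp)
      show "integrable \<mu> (\<lambda>x. B * indicator A x)"
        using A sets by (intro integrable_mult_right) (simp add: emeasure_eq_measure)
      show "h x * indicator A x \<le> B * indicator A x" for x
        using B[of x] by (intro mult_right_mono) auto
    qed
    then show ?thesis
      using A sets space_borel_measure[OF sets] by (simp add: density)
  qed
  show ?thesis
  proof (rule radon_measureI)
    show "finite_measure (density \<mu> h)"
      by (rule finite_measure_continuous_density[OF UNIV fin sets h])
    show "sets (density \<mu> h) = sets borel"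
      by (simp add: sets)
    fix A :: "'a set" and e :: real assume A: "A \<in> sets borel" "e > 0"
    \<comment> \<open>\<open>B\<close> can be 0, hence the division by \<open>B + 1\<close>.\<close>
    then have "e / (B + 1) > 0"
      using \<open>0 \<le> B\<close> by simp
    then obtain K where K: "compact K" "K \<subseteq> A" "measure \<mu> (A - K) < e / (B + 1)"
      by (rule radon_inner_approx[OF fin \<mu> A(1)])
    have "measure (density \<mu> h) (A - K) \<le> B * measure \<mu> (A - K)"
      by (intro le sets.Diff A compact_imp_borel K)
    also have "\<dots> \<le> (B + 1) * measure \<mu> (A - K)"
      by (intro mult_right_mono) auto
    also have "\<dots> < e"
      using K(3) \<open>0 \<le> B\<close> by (simp add: field_simps)
    finally show "\<exists>K. compact K \<and> K \<subseteq> A \<and> measure (density \<mu> h) (A - K) < e"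
      using K by blast
  qed
qed

text \<open>On each block the difference is at most \<open>dist g h\<close> times the mass of the
  block, and over a partition these masses sum to at most \<open>measure \<mu> UNIV\<close>.\<close>

lemma total_variation_density_diff_le:
  fixes \<mu> :: "'a::t2_space measure" and g h :: "'a \<Rightarrow>\<^sub>C real"
  assumes UNIV: "compact (UNIV :: 'a set)" and \<mu>: "finite_measure \<mu>" "sets \<mu> = sets borel"
    and nonneg: "\<And>x. 0 \<le> apply_bcontfun g x" "\<And>x. 0 \<le> apply_bcontfun h x"
  shows "total_variation (\<lambda>A. measure (density \<mu> g) A - measure (density \<mu> h) A) UNIV
    \<le> ennreal (dist g h * measure \<mu> UNIV)"
proof (rule total_variation_least)
  interpret finite_measure \<mu> by fact
  fix P :: "'a set set" assume P: "finite P" "P \<subseteq> sets borel" "disjoint P" "\<Union>P = UNIV"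
  have "\<bar>measure (density \<mu> g) A - measure (density \<mu> h) A\<bar> \<le> dist g h * measure \<mu> A"
    if A: "A \<in> sets borel" for A
  proof -
    have int: "integrable \<mu> (\<lambda>x. apply_bcontfun f x * indicator A x)" for f :: "'a \<Rightarrow>\<^sub>C real"
      by (intro integrable_real_mult_indicator integrable_continuous_compact UNIV \<mu>)
        (use A \<mu>(2) in simp_all)
    have "\<bar>measure (density \<mu> g) A - measure (density \<mu> h) A\<bar> =
        \<bar>\<integral>x. apply_bcontfun g x * indicator A x - apply_bcontfun h x * indicator A x \<partial>\<mu>\<bar>"
      by (simp add: measure_continuous_density[OF UNIV \<mu>] nonneg A int)
    also have "\<dots> \<le> (\<integral>x. \<bar>apply_bcontfun g x * indicator A x - apply_bcontfun h x * indicator A x\<bar> \<partial>\<mu>)"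
      by (rule integral_abs_bound)
    also have "\<dots> \<le> (\<integral>x. dist g h * indicator A x \<partial>\<mu>)"
    proof (rule integral_mono)
      show "integrable \<mu> (\<lambda>x. dist g h * indicator A x)"
        using A \<mu> by (intro integrable_mult_right) (simp add: emeasure_eq_measure)
      show "\<bar>apply_bcontfun g x * indicator A x - apply_bcontfun h x * indicator A x\<bar>
          \<le> dist g h * indicator A x" for x
        using dist_bounded[of g x h] by (auto simp: dist_real_def split: split_indicator)
    qed (intro integrable_abs Bochner_Integration.integrable_diff int)
    also have "\<dots> = dist g h * measure \<mu> A"
      using A \<mu>(2) space_borel_measure[OF \<mu>(2)] by simp
    finally show ?thesis .
  qed
  then have "(\<Sum>A\<in>P. ennreal \<bar>measure (density \<mu> g) A - measure (density \<mu> h) A\<bar>)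
      \<le> (\<Sum>A\<in>P. ennreal (dist g h) * ennreal \<bar>measure \<mu> A\<bar>)"
    using P by (intro sum_mono) (auto simp: ennreal_mult[symmetric] intro!: ennreal_leI)
  also have "\<dots> = ennreal (dist g h) * (\<Sum>A\<in>P. ennreal \<bar>measure \<mu> A\<bar>)"
    by (rule sum_distrib_left[symmetric])
  also have "\<dots> \<le> ennreal (dist g h) * total_variation (measure \<mu>) UNIV"
    by (intro mult_left_mono sum_le_total_variation P) simp
  also have "total_variation (measure \<mu>) UNIV = measure \<mu> UNIV"
    using emeasure_variation_measure[OF signed_measure_measure[OF \<mu>], of UNIV]
    by (simp add: variation_measure_measure[OF \<mu>] emeasure_eq_measure)
  finally show "(\<Sum>A\<in>P. ennreal \<bar>measure (density \<mu> g) A - measure (density \<mu> h) A\<bar>)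
      \<le> ennreal (dist g h * measure \<mu> UNIV)"
    by (simp add: ennreal_mult)
qed

text \<open>
  The library makes \<^typ>\<open>'a \<Rightarrow>\<^sub>C 'b\<close> an instance of \<^class>\<open>complete_space\<close> only for metric
  domains.
\<close>

lemma bcontfun_Cauchy_convergent:
  fixes f :: "nat \<Rightarrow> 'a::topological_space \<Rightarrow>\<^sub>C 'b::complete_space"
  assumes "Cauchy f"
  shows "convergent f"
proof -
  have "\<exists>N. \<forall>m\<ge>N. \<forall>n\<ge>N. \<forall>x. dist (apply_bcontfun (f m) x) (apply_bcontfun (f n) x) < e"
    if "e > 0" for e
    using metric_CauchyD[OF assms that] dist_fun_lt_imp_dist_val_lt by metis
  then have "\<exists>l. \<forall>e>0. \<exists>N. \<forall>n x. N \<le> n \<and> True \<longrightarrow> dist (apply_bcontfun (f n) x) (l x) < e"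
    by (subst uniformly_convergent_eq_cauchy) metis
  then obtain l where "uniform_limit UNIV (\<lambda>n. apply_bcontfun (f n)) l sequentially"
    unfolding uniform_limit_sequentially_iff by blast
  then obtain l' where "f \<longlonglongrightarrow> l'"
    by (rule uniform_limit_bcontfunE[OF _ sequentially_bot])
  then show ?thesis
    by (rule convergentI)
qed

section \<open>Markov kernels with a continuous density\<close>

text \<open>The normalized kernel enters the argument through these properties and an upper bound
  \<open>C\<close>; the unnormalized \<open>k\<close> no longer appears.\<close>

locale continuous_markov_kernel =
  fixes K :: "'a::t2_space \<times> 'a \<Rightarrow> real" and \<mu> :: "'a measure"
  assumes UNIV: "compact (UNIV :: 'a set)"
    and radon: "radon_measure \<mu>"
    and cont: "continuous_on UNIV K"
    and nonneg: "\<And>x y. 0 \<le> K (x, y)"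
    and stochastic: "\<And>x. (\<integral>y. K (x, y) \<partial>\<mu>) = 1"
begin

lemma sets_mu: "sets \<mu> = sets borel"
  using radon by (simp add: radon_measure_def)

lemma space_mu: "space \<mu> = UNIV"
  by (rule space_borel_measure[OF sets_mu])

sublocale finite_measure \<mu>
  by (rule radon_imp_finite_measure[OF UNIV radon])

lemma integrable_mu: "continuous_on UNIV f \<Longrightarrow> integrable \<mu> f" for f :: "'a \<Rightarrow> real"
  by (rule integrable_continuous_compact[OF UNIV finite_measure_axioms sets_mu])

definition operator :: "('a \<Rightarrow>\<^sub>C real) \<Rightarrow> ('a \<Rightarrow>\<^sub>C real)" where
  "operator f = Bcontfun (\<lambda>x. \<integral>y. K (x, y) * apply_bcontfun f y \<partial>\<mu>)"

text \<open>The density, with respect to \<open>\<mu>\<close>, of the image of a measure under the adjoint operator.\<close>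

definition image_density :: "'a measure \<Rightarrow> ('a \<Rightarrow>\<^sub>C real)" where
  "image_density v = Bcontfun (\<lambda>y. \<integral>x. K (x, y) \<partial>v)"

definition densities :: "('a \<Rightarrow>\<^sub>C real) set" where
  "densities = {g. (\<forall>x. 0 \<le> apply_bcontfun g x) \<and> (\<integral>x. apply_bcontfun g x \<partial>\<mu>) = 1}"

definition step :: "('a \<Rightarrow>\<^sub>C real) \<Rightarrow> ('a \<Rightarrow>\<^sub>C real)" where
  "step g = image_density (density \<mu> g)"

lemma continuous_K_mult:
  fixes f :: "'a \<Rightarrow>\<^sub>C real"
  shows "continuous_on UNIV (\<lambda>(x, y). K (x, y) * apply_bcontfun f y)"
  unfolding case_prod_beta
  by (intro continuous_on_mult continuous_on_compose2[OF cont]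
      continuous_on_compose2[OF continuous_on_apply_bcontfun[of UNIV f]] continuous_intros) auto

text \<open>\<open>Bcontfun\<close> can be unfolded only on a bounded continuous function, so
  continuity of the parametric integral has to be established first.\<close>

lemma apply_operator: "apply_bcontfun (operator f) x = (\<integral>y. K (x, y) * apply_bcontfun f y \<partial>\<mu>)"
proof -
  have "continuous_on UNIV (\<lambda>x. \<integral>y. K (x, y) * apply_bcontfun f y \<partial>\<mu>)"
    using continuous_parametric_integral[OF UNIV finite_measure_axioms sets_mu continuous_K_mult]
    by simp
  then show ?thesis
    unfolding operator_def by (simp add: Bcontfun_inverse compact_continuous_bcontfun UNIV)
qed

lemma apply_image_density:
  assumes "finite_measure v" "sets v = sets borel"
  shows "apply_bcontfun (image_density v) y = (\<integral>x. K (x, y) \<partial>v)"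
proof -
  have "continuous_on UNIV (\<lambda>y. \<integral>x. K (x, y) \<partial>v)"
    using continuous_parametric_integral[OF UNIV assms continuous_slice(3)[OF cont]] by simp
  then show ?thesis
    unfolding image_density_def by (simp add: Bcontfun_inverse compact_continuous_bcontfun UNIV)
qed

lemma probability_radon_measureD:
  assumes "probability_radon_measure v"
  shows "finite_measure v" "sets v = sets borel" "measure v UNIV = 1"
proof -
  interpret prob_space v
    using assms by (simp add: probability_radon_measure_def)
  show "finite_measure v" by (rule finite_measure_axioms)
  show "sets v = sets borel"
    using assms by (simp add: probability_radon_measure_def radon_measure_def)
  then show "measure v UNIV = 1"
    using prob_space space_borel_measure by metis
qed

lemma image_density_nonneg:
  assumes "probability_radon_measure v"
  shows "0 \<le> apply_bcontfun (image_density v) y"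
  using probability_radon_measureD[OF assms]
  by (simp add: apply_image_density nonneg)

text \<open>Exchanging the integrals gives the duality between \<open>image_density\<close> and
  \<open>operator\<close>, from which the adjoint is computed.\<close>

lemma integral_image_density:
  assumes v: "probability_radon_measure v"
  shows "(\<integral>y. apply_bcontfun (image_density v) y * apply_bcontfun f y \<partial>\<mu>)
    = (\<integral>x. apply_bcontfun (operator f) x \<partial>v)"
proof -
  note D = probability_radon_measureD[OF v]
  have "(\<integral>y. apply_bcontfun (image_density v) y * apply_bcontfun f y \<partial>\<mu>)
      = (\<integral>y. \<integral>x. K (x, y) * apply_bcontfun f y \<partial>v \<partial>\<mu>)"
    by (simp add: apply_image_density D)
  also have "\<dots> = (\<integral>x. \<integral>y. K (x, y) * apply_bcontfun f y \<partial>\<mu> \<partial>v)"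
    using Fubini_continuous_compact[OF UNIV UNIV continuous_K_mult D(1,2) finite_measure_axioms sets_mu]
    by simp
  also have "\<dots> = (\<integral>x. apply_bcontfun (operator f) x \<partial>v)"
    by (simp add: apply_operator)
  finally show ?thesis .
qed

lemma image_density_in_densities:
  assumes v: "probability_radon_measure v"
  shows "image_density v \<in> densities"
proof -
  note D = probability_radon_measureD[OF v]
  \<comment> \<open>Duality is tested on the constant 1, which \<open>operator\<close> fixes because
    the kernel is stochastic.\<close>
  have "(\<integral>y. apply_bcontfun (image_density v) y \<partial>\<mu>) = (\<integral>x. apply_bcontfun (operator (const_bcontfun 1)) x \<partial>v)"
    using integral_image_density[OF v, of "const_bcontfun 1"] by (simp add: const_bcontfun.rep_eq)
  also have "\<dots> = 1"
    using D(3) by (simp add: apply_operator const_bcontfun.rep_eq stochastic space_borel_measure[OF D(2)])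
  finally show ?thesis
    by (simp add: densities_def image_density_nonneg[OF v])
qed

lemma
  assumes "g \<in> densities"
  shows probability_radon_measure_density: "probability_radon_measure (density \<mu> g)"
    and integral_density_densities: "continuous_on UNIV f \<Longrightarrow> integral\<^sup>L (density \<mu> g) f = (\<integral>x. apply_bcontfun g x * f x \<partial>\<mu>)"
proof -
  have g: "\<And>x. 0 \<le> apply_bcontfun g x" "(\<integral>x. apply_bcontfun g x \<partial>\<mu>) = 1"
    using assms by (auto simp: densities_def)
  note facts = finite_measure_axioms sets_mu continuous_on_apply_bcontfun g(1)
  interpret g: finite_measure "density \<mu> g"
    by (rule finite_measure_continuous_density[OF UNIV facts])
  have "measure (density \<mu> g) UNIV = 1"
    using measure_continuous_density[OF UNIV facts, of UNIV] g(2) by simp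
  then have "prob_space (density \<mu> g)"
    by (intro prob_spaceI) (simp add: space_mu g.emeasure_eq_measure)
  then show "probability_radon_measure (density \<mu> g)"
    unfolding probability_radon_measure_def
    by (intro conjI radon_measure_continuous_density UNIV radon g(1)) simp_all
  show "continuous_on UNIV f \<Longrightarrow> integral\<^sup>L (density \<mu> g) f = (\<integral>x. apply_bcontfun g x * f x \<partial>\<mu>)"
    by (rule integral_continuous_density[OF UNIV facts])
qed

lemma signed_radon_measure_probability:
  assumes "probability_radon_measure v"
  shows "signed_radon_measure (measure v)"
  using probability_radon_measureD[OF assms] assms
  by (simp add: signed_radon_measure_def signed_measure_measure variation_measure_measure
      probability_radon_measure_def)

text \<open>Duality shows that the density measure satisfies the defining equation. It is the only
  solution since integrals of continuous functions determine a signed Radon measure.\<close>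

lemma adjoint_eq:
  assumes v: "probability_radon_measure v"
  shows "adjoint_on_measures operator (measure v) = measure (density \<mu> (image_density v))"
  unfolding adjoint_on_measures_def
proof (rule the_equality)
  let ?w = "density \<mu> (image_density v)"
  have w: "probability_radon_measure ?w"
    by (rule probability_radon_measure_density[OF image_density_in_densities[OF v]])
  have eq: "signed_integral (measure ?w) (apply_bcontfun f)
      = signed_integral (measure v) (apply_bcontfun (operator f))" for f
    using probability_radon_measureD[OF w] probability_radon_measureD[OF v]
      integral_density_densities[OF image_density_in_densities[OF v], of "apply_bcontfun f"]
    by (simp add: signed_integral_measure integral_image_density[OF v])
  then show "signed_radon_measure (measure ?w) \<and> (\<forall>f. signed_integral (measure ?w) (apply_bcontfun f)
      = signed_integral (measure v) (apply_bcontfun (operator f)))"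
    using signed_radon_measure_probability[OF w] by blast
  fix u assume "signed_radon_measure u \<and> (\<forall>f. signed_integral u (apply_bcontfun f)
      = signed_integral (measure v) (apply_bcontfun (operator f)))"
  then show "u = measure ?w"
    by (intro signed_radon_measure_eqI UNIV signed_radon_measure_probability w) (auto simp: eq)
qed

section \<open>Iteration and contraction on densities\<close>

lemma step_in_densities: "g \<in> densities \<Longrightarrow> step g \<in> densities"
  unfolding step_def by (intro image_density_in_densities probability_radon_measure_density)

lemma step_iterate_in_densities: "g \<in> densities \<Longrightarrow> (step ^^ n) g \<in> densities"
  by (induction n) (auto intro: step_in_densities)

text \<open>The exponent is \<open>Suc n\<close> because \<open>v\<close> itself may have no
  density: the first application creates one and \<open>step\<close> acts \<open>n\<close> times on
  it.\<close>

lemma adjoint_iterate: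
  assumes v: "probability_radon_measure v"
  shows "(adjoint_on_measures operator ^^ Suc n) (measure v)
    = measure (density \<mu> ((step ^^ n) (image_density v)))"
proof (induction n)
  case 0
  show ?case by (simp add: adjoint_eq[OF v])
next
  case (Suc n)
  have "probability_radon_measure (density \<mu> ((step ^^ n) (image_density v)))"
    by (intro probability_radon_measure_density step_iterate_in_densities image_density_in_densities v)
  with Suc show ?case
    by (simp add: adjoint_eq flip: step_def)
qed

lemma apply_step:
  "g \<in> densities \<Longrightarrow> apply_bcontfun (step g) y = (\<integral>x. apply_bcontfun g x * K (x, y) \<partial>\<mu>)"
  unfolding step_def
  using probability_radon_measureD[OF probability_radon_measure_density] integral_density_densities
  by (simp add: apply_image_density continuous_slice[OF cont])

lemma dist_step_le:
  assumes C: "\<And>x y. K (x, y) \<le> C" and g: "g \<in> densities" and h: "h \<in> densities"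
  shows "dist (step g) (step h) \<le> C / 2 * measure \<mu> UNIV * dist g h"
proof (rule dist_bound)
  fix y
  let ?d = "\<lambda>x. apply_bcontfun g x - apply_bcontfun h x"
  have int: "integrable \<mu> (\<lambda>x. apply_bcontfun f x * K (x, y))" "integrable \<mu> (apply_bcontfun f)"
    for f :: "'a \<Rightarrow>\<^sub>C real"
    by (intro integrable_mu continuous_intros continuous_slice[OF cont] continuous_on_apply_bcontfun)+
  have "(\<integral>x. ?d x * (K (x, y) - C / 2) \<partial>\<mu>)
      = (\<integral>x. (apply_bcontfun g x * K (x, y) - apply_bcontfun h x * K (x, y))
          - C / 2 * (apply_bcontfun g x - apply_bcontfun h x) \<partial>\<mu>)"
    by (intro Bochner_Integration.integral_cong) (auto simp: algebra_simps)
  also have "\<dots> = (\<integral>x. apply_bcontfun g x * K (x, y) \<partial>\<mu>) - (\<integral>x. apply_bcontfun h x * K (x, y) \<partial>\<mu>)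
      - C / 2 * ((\<integral>x. apply_bcontfun g x \<partial>\<mu>) - (\<integral>x. apply_bcontfun h x \<partial>\<mu>))"
    by (simp only: Bochner_Integration.integral_diff Bochner_Integration.integrable_diff
        integrable_mult_right integral_mult_right_zero int)
  \<comment> \<open>\<open>g\<close> and \<open>h\<close> both have integral 1, so the
    \<open>C / 2\<close> term vanishes.\<close>
  also have "\<dots> = apply_bcontfun (step g) y - apply_bcontfun (step h) y"
    using g h by (simp add: apply_step) (simp add: densities_def)
  finally have "dist (apply_bcontfun (step g) y) (apply_bcontfun (step h) y)
      = \<bar>\<integral>x. ?d x * (K (x, y) - C / 2) \<partial>\<mu>\<bar>"
    by (simp add: dist_real_def)
  also have "\<dots> \<le> dist g h * (C / 2) * measure \<mu> (space \<mu>)"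
  proof (rule abs_integral_le_bound)
    show "integrable \<mu> (\<lambda>x. ?d x * (K (x, y) - C / 2))"
      by (intro integrable_mu continuous_intros continuous_slice[OF cont] continuous_on_apply_bcontfun)
    show "\<bar>?d x * (K (x, y) - C / 2)\<bar> \<le> dist g h * (C / 2)" for x
      unfolding abs_mult
    proof (rule mult_mono)
      show "\<bar>?d x\<bar> \<le> dist g h"
        using dist_bounded[of g x h] by (simp add: dist_real_def)
      show "\<bar>K (x, y) - C / 2\<bar> \<le> C / 2"
        using C[of x y] nonneg[of x y] by linarith
    qed auto
  qed
  finally show "dist (apply_bcontfun (step g) y) (apply_bcontfun (step h) y)
      \<le> C / 2 * measure \<mu> UNIV * dist g h"
    by (simp add: space_mu mult_ac)
qed

text \<open>Uniform limits preserve nonnegativity pointwise, and they preserve the integral because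
  \<mu> is finite.\<close>

lemma complete_densities: "Topological_Spaces.complete densities"
proof (rule completeI)
  fix g :: "nat \<Rightarrow> 'a \<Rightarrow>\<^sub>C real"
  assume "\<forall>n. g n \<in> densities" and "Cauchy g"
  moreover from bcontfun_Cauchy_convergent[OF \<open>Cauchy g\<close>] obtain l where "g \<longlonglongrightarrow> l"
    by (auto simp: convergent_def)
  ultimately have g: "\<And>n x. 0 \<le> apply_bcontfun (g n) x" "\<And>n. (\<integral>x. apply_bcontfun (g n) x \<partial>\<mu>) = 1"
    and lim: "g \<longlonglongrightarrow> l"
    by (auto simp: densities_def)
  have dist: "(\<lambda>n. dist (g n) l) \<longlonglongrightarrow> 0"
    using lim by (rule tendsto_dist_iff[THEN iffD1])
  have "(\<lambda>n. apply_bcontfun (g n) x) \<longlonglongrightarrow> apply_bcontfun l x" for x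
    by (rule tendsto_dist_iff[THEN iffD2],
        rule tendsto_sandwich[OF _ _ tendsto_const dist]) (auto simp: dist_bounded)
  then have "0 \<le> apply_bcontfun l x" for x
    by (rule LIMSEQ_le_const) (use g(1) in auto)
  moreover have "(\<integral>x. apply_bcontfun l x \<partial>\<mu>) = 1"
  proof -
    have "\<bar>(\<integral>x. apply_bcontfun l x \<partial>\<mu>) - 1\<bar> \<le> dist (g n) l * measure \<mu> UNIV" for n
    proof -
      have "\<bar>\<integral>x. apply_bcontfun l x - apply_bcontfun (g n) x \<partial>\<mu>\<bar> \<le> dist (g n) l * measure \<mu> (space \<mu>)"
        by (intro abs_integral_le_bound)
          (use dist_bounded[of l _ "g n"] in
            \<open>auto simp: dist_real_def dist_commute[of "g n"] integrable_mu\<close>)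
      then show ?thesis
        by (simp add: space_mu g(2) integrable_mu)
    qed
    moreover have "(\<lambda>n. dist (g n) l * measure \<mu> UNIV) \<longlonglongrightarrow> 0"
      using tendsto_mult_left_zero[OF dist] .
    ultimately have "\<bar>(\<integral>x. apply_bcontfun l x \<partial>\<mu>) - 1\<bar> \<le> 0"
      by (intro LIMSEQ_le_const) auto
    then show ?thesis by simp
  qed
  ultimately show "\<exists>l\<in>densities. g \<longlonglongrightarrow> l"
    using lim by (auto simp: densities_def)
qed

text \<open>Any row of the kernel is a density; \<open>undefined\<close> merely names a
  point.\<close>

lemma densities_nonempty: "densities \<noteq> {}"
proof -
  have "apply_bcontfun (Bcontfun (\<lambda>y. K (undefined, y))) = (\<lambda>y. K (undefined, y))"
    by (intro Bcontfun_inverse compact_continuous_bcontfun UNIV continuous_slice cont)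
  then have "Bcontfun (\<lambda>y. K (undefined, y)) \<in> densities"
    by (simp add: densities_def nonneg stochastic)
  then show ?thesis by blast
qed

lemma invariant_measure_unique_convergence:
  assumes C: "\<And>x y. K (x, y) \<le> C" and small: "C / 2 * measure \<mu> UNIV < 1"
  shows "\<exists>!w. probability_radon_measure w \<and>
    adjoint_on_measures operator (measure w) = measure w \<and>
    (\<forall>v. probability_radon_measure v \<longrightarrow>
      (\<lambda>n. total_variation (\<lambda>A. (adjoint_on_measures operator ^^ n) (measure v) A - measure w A) UNIV)
        \<longlonglongrightarrow> 0)"
proof -
  define q where "q = C / 2 * measure \<mu> UNIV"
  have "0 \<le> C"
    using C[of undefined undefined] nonneg[of undefined undefined] by linarith
  then have q: "0 \<le> q" "q < 1"
    using small by (simp_all add: q_def)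
  have contraction: "dist (step g) (step h) \<le> q * dist g h" if "g \<in> densities" "h \<in> densities" for g h
    unfolding q_def by (rule dist_step_le[OF C that])
  obtain g where g: "g \<in> densities" "step g = g"
    using Banach_fix[OF complete_densities densities_nonempty q, of step] contraction step_in_densities
    by blast
  define w where "w = density \<mu> g"
  have w: "probability_radon_measure w"
    unfolding w_def by (rule probability_radon_measure_density[OF g(1)])
  have "image_density w = g"
    using g(2) by (simp add: step_def w_def)
  then have inv: "adjoint_on_measures operator (measure w) = measure w"
    using adjoint_eq[OF w] by (simp add: w_def)
  have conv: "(\<lambda>n. total_variation (\<lambda>A. (adjoint_on_measures operator ^^ n) (measure v) A - measure w A) UNIV)
      \<longlonglongrightarrow> 0" if v: "probability_radon_measure v" for v
  proof -
    define h where "h n = (step ^^ n) (image_density v)" for n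
    have h: "h n \<in> densities" for n
      unfolding h_def by (intro step_iterate_in_densities image_density_in_densities v)
    have dist: "dist (h n) g \<le> q ^ n * dist (h 0) g" for n
    proof (induction n)
      case (Suc n)
      have "dist (h (Suc n)) g = dist (step (h n)) (step g)"
        by (simp add: h_def g(2))
      also have "\<dots> \<le> q * dist (h n) g"
        by (rule contraction[OF h g(1)])
      also have "\<dots> \<le> q * (q ^ n * dist (h 0) g)"
        by (intro mult_left_mono Suc q)
      finally show ?case by simp
    qed simp
    have le: "total_variation (\<lambda>A. (adjoint_on_measures operator ^^ Suc n) (measure v) A - measure w A) UNIV
        \<le> ennreal (q ^ n * (dist (h 0) g * measure \<mu> UNIV))" for n
    proof -
      have "total_variation (\<lambda>A. measure (density \<mu> (h n)) A - measure (density \<mu> g) A) UNIV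
          \<le> ennreal (dist (h n) g * measure \<mu> UNIV)"
        by (rule total_variation_density_diff_le[OF UNIV finite_measure_axioms sets_mu])
          (use h[of n] g(1) in \<open>simp_all add: densities_def\<close>)
      also have "\<dots> \<le> ennreal (q ^ n * (dist (h 0) g * measure \<mu> UNIV))"
        unfolding mult.assoc[symmetric] by (intro ennreal_leI mult_right_mono dist) simp
      finally show ?thesis
        unfolding adjoint_iterate[OF v] h_def w_def .
    qed
    have "(\<lambda>n. ennreal (q ^ n * (dist (h 0) g * measure \<mu> UNIV))) \<longlonglongrightarrow> ennreal 0"
      using LIMSEQ_realpow_zero[OF q] by (intro tendsto_ennrealI tendsto_mult_left_zero)
    then have bound: "(\<lambda>n. ennreal (q ^ n * (dist (h 0) g * measure \<mu> UNIV))) \<longlonglongrightarrow> 0"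
      by simp
    have "(\<lambda>n. total_variation
        (\<lambda>A. (adjoint_on_measures operator ^^ Suc n) (measure v) A - measure w A) UNIV) \<longlonglongrightarrow> 0"
      by (rule tendsto_sandwich[OF always_eventually always_eventually tendsto_const bound])
        (intro allI zero_le le)+
    \<comment> \<open>The geometric bound starts at the first iterate; dropping the initial term
      does not affect the limit.\<close>
    then show ?thesis
      by (rule LIMSEQ_imp_Suc)
  qed
  show ?thesis
  proof (rule ex1I[of _ w])
    show "probability_radon_measure w \<and> adjoint_on_measures operator (measure w) = measure w \<and>
      (\<forall>v. probability_radon_measure v \<longrightarrow>
        (\<lambda>n. total_variation (\<lambda>A. (adjoint_on_measures operator ^^ n) (measure v) A - measure w A) UNIV)
          \<longlonglongrightarrow> 0)"
      using w inv conv by blast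
  next
    fix u assume "probability_radon_measure u \<and> adjoint_on_measures operator (measure u) = measure u \<and>
      (\<forall>v. probability_radon_measure v \<longrightarrow>
        (\<lambda>n. total_variation (\<lambda>A. (adjoint_on_measures operator ^^ n) (measure v) A - measure u A) UNIV)
          \<longlonglongrightarrow> 0)"
    then have u: "probability_radon_measure u" "adjoint_on_measures operator (measure u) = measure u"
      by auto
    \<comment> \<open>Uniqueness follows by starting the iteration at \<open>u\<close>: its iterates
      are constant and converge to \<open>w\<close>, so the total variation of the difference is
      0.\<close>
    have "(adjoint_on_measures operator ^^ n) (measure u) = measure u" for n
      by (induction n) (simp_all add: u)
    then have "(\<lambda>n::nat. total_variation (\<lambda>A. measure u A - measure w A) UNIV) \<longlonglongrightarrow> 0"
      using conv[OF u(1)] by simp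
    then have TV: "total_variation (\<lambda>A. measure u A - measure w A) UNIV = 0"
      by (simp add: LIMSEQ_const_iff)
    interpret u: finite_measure u by (rule probability_radon_measureD(1)[OF u(1)])
    interpret w: finite_measure w by (rule probability_radon_measureD(1)[OF w])
    have sets: "sets u = sets borel" "sets w = sets borel"
      using probability_radon_measureD u(1) w by auto
    show "u = w"
    proof (rule measure_eqI)
      fix A assume "A \<in> sets u"
      then have "measure u A = measure w A"
        using abs_le_total_variation[of A UNIV "\<lambda>A. measure u A - measure w A"] TV sets by simp
      then show "emeasure u A = emeasure w A"
        by (simp add: u.emeasure_eq_measure w.emeasure_eq_measure)
    qed (simp add: sets)
  qed
qed

end

section \<open>Application to the normalized kernel\<close>

theorem proposition4p6:
  fixes k :: "'a::t2_space \<times> 'a \<Rightarrow> real" and \<mu> :: "'a measure"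
  assumes "compact (UNIV :: 'a set)"
    and "continuous_on UNIV k"
    and "\<And>x y. k (x, y) \<ge> 0"
    and "radon_measure \<mu>"
    and "\<And>x. (\<integral>y. k (x, y) \<partial>\<mu>) > 0"
    and "(SUP p. \<bar>normalized_kernel \<mu> k p\<bar>) < 2 / measure \<mu> UNIV"
  shows "\<exists>!w :: 'a measure.
           probability_radon_measure w \<and>
           adjoint_on_measures (kernel_operator \<mu> k) (measure w) = measure w \<and>
           (\<forall>v. probability_radon_measure v \<longrightarrow>
              (\<lambda>n. total_variation
                     (\<lambda>A. (adjoint_on_measures (kernel_operator \<mu> k) ^^ n) (measure v) A - measure w A)
                     UNIV) \<longlonglongrightarrow> 0)"
proof -
  have \<mu>: "finite_measure \<mu>" "sets \<mu> = sets borel"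
    using radon_imp_finite_measure[OF assms(1,4)] assms(4) by (simp_all add: radon_measure_def)
  have K: "normalized_kernel \<mu> k = (\<lambda>p. k p / (\<integral>z. k (fst p, z) \<partial>\<mu>))"
    by (auto simp: normalized_kernel_def)
  have cont: "continuous_on UNIV (normalized_kernel \<mu> k)"
    unfolding K
  proof (intro continuous_on_divide assms(2) ballI)
    show "continuous_on UNIV (\<lambda>p. \<integral>z. k (fst p, z) \<partial>\<mu>)"
      by (rule continuous_on_compose2[OF continuous_parametric_integral[OF assms(1) \<mu> assms(2)]])
        (auto intro: continuous_intros)
    show "(\<integral>z. k (fst p, z) \<partial>\<mu>) \<noteq> 0" for p :: "'a \<times> 'a"
      using assms(5)[of "fst p"] by simp
  qed
  interpret continuous_markov_kernel "normalized_kernel \<mu> k" \<mu>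
  proof
    show "0 \<le> normalized_kernel \<mu> k (x, y)" for x y
      using assms(3)[of x y] assms(5)[of x] by (simp add: K)
    show "(\<integral>y. normalized_kernel \<mu> k (x, y) \<partial>\<mu>) = 1" for x
      using assms(5)[of x] by (simp add: K)
  qed (fact assms(1) assms(4) cont)+
  define C where "C = (SUP p. \<bar>normalized_kernel \<mu> k p\<bar>)"
  \<comment> \<open>The real supremum is an upper bound only for a set bounded above; compactness
    provides the boundedness.\<close>
  have "bounded (normalized_kernel \<mu> k ` (UNIV \<times> UNIV))"
    by (intro compact_imp_bounded compact_continuous_image compact_Times assms(1)) (use cont in simp)
  then have bdd: "bdd_above (range (\<lambda>p. \<bar>normalized_kernel \<mu> k p\<bar>))"
    by (auto simp: bounded_iff bdd_above_def)
  have abs_le: "\<bar>normalized_kernel \<mu> k p\<bar> \<le> C" for p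
    unfolding C_def by (rule cSUP_upper[OF _ bdd]) simp
  have "0 \<le> C"
    using abs_le[of undefined] by linarith
  have C: "C < 2 / measure \<mu> UNIV"
    using assms(6) by (simp add: C_def)
  \<comment> \<open>Division by zero yields 0, so a vanishing total mass would give
    \<open>C < 0\<close>.\<close>
  with \<open>0 \<le> C\<close> have "measure \<mu> UNIV \<noteq> 0"
    by auto
  then have "measure \<mu> UNIV > 0"
    using measure_nonneg[of \<mu> UNIV] by linarith
  with C have "C / 2 * measure \<mu> UNIV < 1"
    by (simp add: field_simps)
  moreover have "normalized_kernel \<mu> k (x, y) \<le> C" for x y
    using abs_le[of "(x, y)"] by linarith
  moreover have "kernel_operator \<mu> k = operator"
    by (simp add: fun_eq_iff kernel_operator_def operator_def)
  ultimately show ?thesis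
    using invariant_measure_unique_convergence[of C] by simp
qed

end
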